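(* Let $T$ be a unilateral weighted shift with bounded complex weight sequence $\{\alpha_n\}_{n\ge1}$ having a zero gap, that is, for some $i\ge1$ one has $\alpha_i\ne0$ and $\alpha_{i+1}=0$. Then the following are equivalent: (i) $\mathcal S(T,T^* )$ is an SI semigroup. (ii) $|\alpha_n|\in\{0,1\}$ for all $n\ge1$. (iii) $T$ is a power partial isometry. Furthermore, these SI semigroups $\mathcal S(T,T^* )$ are always nonsimple.
   Context: For an orthonormal basis $\{e_n\}_{n\ge1}$ of a Hilbert space $\mathcal H$, the weighted shift with weights $\{\alpha_n\}$ is the bounded operator with $Te_n=\alpha_ne_{n+1}$, $n\ge1$. $T$ is a power partial isometry if $T^k$ is a partial isometry for every $k\ge1$. $\mathcal S(T,T^* )$ is the multiplicative semigroup of all finite nonempty products of $T$ and $T^*$. An ideal of a semigroup $\mathcal S$ is a nonempty subset $J\subset\mathcal S$ with $XA,AX\in J$ for $A\in J$, $X\in\mathcal S$. $\mathcal S$ is simple if its only ideal is $\mathcal S$ itself, nonsimple otherwise. $\mathcal S$ is an SI (selfadjoint-ideal) semigroup if every ideal $J$ of $\mathcal S$ satisfies $J^*=\{A^*:A\in J\}\subset J$. *)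

theory Defs
  imports "HOL-Analysis.Analysis"
begin

(* Complex Hilbert spaces. The real inner product structure of real_inner, and with it the norm
   and the topology, is the one underlying the complex inner product; cinner is linear in its
   first and conjugate-linear in its second argument. *)
class complex_hilbert_space = real_inner + complete_space +
  fixes scaleC :: "complex \<Rightarrow> 'a \<Rightarrow> 'a"  (infixr \<open>*\<^sub>C\<close> 75)
    and cinner :: "'a \<Rightarrow> 'a \<Rightarrow> complex"
  assumes scaleC_add_right: "a *\<^sub>C (x + y) = a *\<^sub>C x + a *\<^sub>C y"
    and scaleC_add_left: "(a + b) *\<^sub>C x = a *\<^sub>C x + b *\<^sub>C x"
    and scaleC_scaleC: "a *\<^sub>C b *\<^sub>C x = (a * b) *\<^sub>C x"
    and scaleR_scaleC: "scaleR r x = complex_of_real r *\<^sub>C x"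
    and cinner_commute: "cinner x y = cnj (cinner y x)"
    and cinner_add_left: "cinner (x + y) z = cinner x z + cinner y z"
    and cinner_scaleC_left: "cinner (a *\<^sub>C x) y = a * cinner x y"
    and inner_eq_Re_cinner: "inner x y = Re (cinner x y)"

global_interpretation complex_vector:
  vector_space "scaleC :: complex \<Rightarrow> 'a \<Rightarrow> 'a::complex_hilbert_space"
proof
  fix x :: 'a
  show "1 *\<^sub>C x = x"
    using scaleR_scaleC[of 1 x] by simp
qed (rule scaleC_add_right scaleC_add_left scaleC_scaleC)+

lemma cinner_self: "cinner x x = complex_of_real ((norm x)\<^sup>2)"
proof (rule complex_eqI)
  show "Re (cinner x x) = Re (complex_of_real ((norm x)\<^sup>2))"
    using inner_eq_Re_cinner[of x x] by (simp add: power2_norm_eq_inner)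
  show "Im (cinner x x) = Im (complex_of_real ((norm x)\<^sup>2))"
    using arg_cong[OF cinner_commute[of x x], of Im] by simp
qed

definition orthonormal_basis :: "'i set \<Rightarrow> ('i \<Rightarrow> 'a::complex_hilbert_space) \<Rightarrow> bool" where
  "orthonormal_basis I e \<longleftrightarrow>
     (\<forall>i\<in>I. \<forall>j\<in>I. cinner (e i) (e j) = (if i = j then 1 else 0)) \<and>
     closure (complex_vector.span (e ` I)) = UNIV"

definition bounded_clinear ::
    "('a::complex_hilbert_space \<Rightarrow> 'b::complex_hilbert_space) \<Rightarrow> bool" where
  "bounded_clinear A \<longleftrightarrow> bounded_linear A \<and> (\<forall>c x. A (c *\<^sub>C x) = c *\<^sub>C A x)"

(* For bounded_clinear A such a B exists (Riesz representation) and is unique. *)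
definition cadjoint ::
    "('a::complex_hilbert_space \<Rightarrow> 'b::complex_hilbert_space) \<Rightarrow> 'b \<Rightarrow> 'a" where
  "cadjoint A = (THE B. \<forall>x y. cinner (A x) y = cinner x (B y))"

(* The weights and the basis are indexed by n \<ge> 1; values at 0 are irrelevant. *)
definition weighted_shift ::
    "(nat \<Rightarrow> 'a::complex_hilbert_space) \<Rightarrow> (nat \<Rightarrow> complex) \<Rightarrow> ('a \<Rightarrow> 'a) \<Rightarrow> bool" where
  "weighted_shift e \<alpha> T \<longleftrightarrow>
     orthonormal_basis {1..} e \<and> bounded_clinear T \<and>
     (\<forall>n\<ge>1. T (e n) = \<alpha> n *\<^sub>C e (n + 1))"

(* Isometric on the orthogonal complement of the kernel. *)
definition partial_isometry :: "('a::complex_hilbert_space \<Rightarrow> 'a) \<Rightarrow> bool" where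
  "partial_isometry A \<longleftrightarrow>
     bounded_clinear A \<and>
     (\<forall>x. (\<forall>y. A y = 0 \<longrightarrow> cinner x y = 0) \<longrightarrow> norm (A x) = norm x)"

definition power_partial_isometry :: "('a::complex_hilbert_space \<Rightarrow> 'a) \<Rightarrow> bool" where
  "power_partial_isometry A \<longleftrightarrow> (\<forall>k\<ge>1. partial_isometry (A ^^ k))"

definition star_semigroup ::
    "('a::complex_hilbert_space \<Rightarrow> 'a) \<Rightarrow> ('a \<Rightarrow> 'a) set" where
  "star_semigroup T = {foldr (\<circ>) ws id |ws. ws \<noteq> [] \<and> set ws \<subseteq> {T, cadjoint T}}"

definition semigroup_ideal :: "('a \<Rightarrow> 'a) set \<Rightarrow> ('a \<Rightarrow> 'a) set \<Rightarrow> bool" where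
  "semigroup_ideal S J \<longleftrightarrow>
     J \<noteq> {} \<and> J \<subseteq> S \<and> (\<forall>A\<in>J. \<forall>X\<in>S. X \<circ> A \<in> J \<and> A \<circ> X \<in> J)"

definition simple_semigroup :: "('a \<Rightarrow> 'a) set \<Rightarrow> bool" where
  "simple_semigroup S \<longleftrightarrow> (\<forall>J. semigroup_ideal S J \<longrightarrow> J = S)"

definition SI_semigroup :: "('a::complex_hilbert_space \<Rightarrow> 'a) set \<Rightarrow> bool" where
  "SI_semigroup S \<longleftrightarrow> (\<forall>J. semigroup_ideal S J \<longrightarrow> cadjoint ` J \<subseteq> J)"

end

theory Submission
  imports Defs
begin

text \<open>Every word W in T and T* is compared with T* through its action on basis vectors. If all weights
  are unimodular or zero, W W* W = W on the basis, hence everywhere; this makes the powers of T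
  partial isometries and puts W* = W* W W* into every ideal containing W. Conversely, the words
  containing the letter T form an ideal, so under SI the operator T* is such a word. At the two ends
  of a finite block of nonzero weights the word has no freedom: it must be T* (T T*)^k with k \<ge> 1,
  and comparing coefficients gives \<bar>\<alpha> n\<bar>^(2k) = 1 for all nonzero weights. The words
  vanishing on the reducing span of e 1, ..., e (i + 1) form a proper ideal.\<close>

section \<open>Adjoints on complex Hilbert spaces\<close>

lemma cinner_add_right: "cinner x (y + z) = cinner x y + cinner x z"
  by (metis cinner_add_left cinner_commute complex_cnj_add)

lemma cinner_scaleC_right: "cinner x (c *\<^sub>C y) = cnj c * cinner x y"
  by (metis cinner_commute cinner_scaleC_left complex_cnj_mult)

lemma cinner_zero_left [simp]: "cinner 0 y = 0"
  using cinner_add_left[of 0 0 y] by simp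

lemma cinner_zero_right [simp]: "cinner x 0 = 0"
  using cinner_add_right[of x 0 0] by simp

lemma cinner_diff_right: "cinner x (y - z) = cinner x y - cinner x z"
  using cinner_add_right[of x "y - z" z] by simp

text \<open>Since Re (-i z) = Im z, the complex inner product is assembled from two real ones; its
  continuity is then inherited from \<open>inner\<close>.\<close>

lemma cinner_eq_Complex: "cinner x y = Complex (inner x y) (inner ((- \<i>) *\<^sub>C x) y)"
  by (rule complex_eqI) (simp_all add: inner_eq_Re_cinner cinner_scaleC_left del: complex_vector.scale_minus_left)

lemma tendsto_cinner_right:
  "(f \<longlongrightarrow> y) F \<Longrightarrow> ((\<lambda>t. cinner x (f t)) \<longlongrightarrow> cinner x y) F"
  unfolding cinner_eq_Complex by (intro tendsto_Complex tendsto_inner tendsto_const)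

lemma tendsto_cinner_left:
  "(f \<longlongrightarrow> y) F \<Longrightarrow> ((\<lambda>t. cinner (f t) x) \<longlongrightarrow> cinner y x) F"
  by (subst (1 2) cinner_commute) (intro tendsto_cnj tendsto_cinner_right)

lemma cinner_right_cancel:
  assumes "\<And>x. cinner x y = cinner x z"
  shows "y = z"
  using assms[of "y - z"] cinner_self[of "y - z"] by (simp add: cinner_diff_right)

lemma norm_scaleC: "norm (c *\<^sub>C x) = cmod c * norm x"
proof -
  have "complex_of_real ((norm (c *\<^sub>C x))\<^sup>2) = complex_of_real ((cmod c * norm x)\<^sup>2)"
    unfolding cinner_self[symmetric] cinner_scaleC_left cinner_scaleC_right
    by (simp add: cinner_self power_mult_distrib complex_norm_square mult.assoc [symmetric]
        del: of_real_power)
  then have "(norm (c *\<^sub>C x))\<^sup>2 = (cmod c * norm x)\<^sup>2"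
    using of_real_eq_iff by blast
  then show ?thesis
    by (simp add: power2_eq_iff_nonneg)
qed

lemma bounded_clinearD:
  assumes "bounded_clinear A"
  shows "bounded_linear A" and "A (x + y) = A x + A y" and "A (c *\<^sub>C x) = c *\<^sub>C A x" and "A 0 = 0"
proof -
  show "bounded_linear A" "A (c *\<^sub>C x) = c *\<^sub>C A x"
    using assms by (simp_all add: bounded_clinear_def)
  then show "A (x + y) = A x + A y" "A 0 = 0"
    using linear_add[OF bounded_linear.linear] linear_0[OF bounded_linear.linear] by blast+
qed

lemma bounded_clinear_compose:
  "bounded_clinear A \<Longrightarrow> bounded_clinear B \<Longrightarrow> bounded_clinear (A \<circ> B)"
  unfolding bounded_clinear_def comp_def by (auto intro: bounded_linear_compose)

text \<open>The relation makes sense before any adjoint is known to exist and passes to products,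
  whereas \<open>cadjoint\<close> is a definite description that needs existence first.\<close>

definition adjoint_pair ::
    "('a::complex_hilbert_space \<Rightarrow> 'b::complex_hilbert_space) \<Rightarrow> ('b \<Rightarrow> 'a) \<Rightarrow> bool" where
  "adjoint_pair A B \<longleftrightarrow> (\<forall>x y. cinner (A x) y = cinner x (B y))"

lemma adjoint_pair_sym: "adjoint_pair A B \<Longrightarrow> adjoint_pair B A"
  unfolding adjoint_pair_def by (metis cinner_commute)

lemma adjoint_pair_compose:
  "adjoint_pair A B \<Longrightarrow> adjoint_pair A' B' \<Longrightarrow> adjoint_pair (A \<circ> A') (B' \<circ> B)"
  by (simp add: adjoint_pair_def)

lemma cadjoint_eqI:
  assumes "adjoint_pair A B"
  shows "cadjoint A = B"
  unfolding cadjoint_def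
proof (rule the_equality)
  show "\<forall>x y. cinner (A x) y = cinner x (B y)"
    using assms by (simp add: adjoint_pair_def)
next
  fix C assume "\<forall>x y. cinner (A x) y = cinner x (C y)"
  then show "C = B"
    using assms by (intro ext cinner_right_cancel) (metis adjoint_pair_def)
qed

text \<open>Put x = z and apply Cauchy-Schwarz. The bound concerns one pair y, z only, so it serves
  both for the boundedness of an adjoint and for constructing its values by limits.\<close>

lemma adjoint_vector_norm_le:
  assumes A: "bounded_clinear A" and z: "\<And>x. cinner (A x) y = cinner x z"
  shows "norm z \<le> onorm A * norm y"
proof (cases "z = 0")
  case True
  then show ?thesis
    using onorm_pos_le[OF bounded_clinearD(1)[OF A]] by simp
next
  case False
  have "norm z * norm z = inner (A z) y"
    using z[of z] by (simp add: inner_eq_Re_cinner cinner_self power2_eq_square)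
  also have "\<dots> \<le> norm (A z) * norm y"
    by (rule norm_cauchy_schwarz)
  also have "\<dots> \<le> (onorm A * norm z) * norm y"
    by (intro mult_right_mono onorm bounded_clinearD(1)[OF A] norm_ge_zero)
  finally show ?thesis
    using False by (simp add: mult.assoc mult.left_commute)
qed

lemma bounded_clinear_adjoint_pair:
  assumes A: "bounded_clinear A" and AB: "adjoint_pair A B"
  shows "bounded_clinear B"
proof -
  have eq: "cinner (A x) y = cinner x (B y)" for x y
    using AB by (simp add: adjoint_pair_def)
  have add: "B (x + y) = B x + B y" for x y
    by (rule cinner_right_cancel) (simp add: eq[symmetric] cinner_add_right)
  have scale: "B (c *\<^sub>C x) = c *\<^sub>C B x" for c x
    by (rule cinner_right_cancel) (simp add: eq[symmetric] cinner_scaleC_right)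
  have "bounded_linear B"
  proof (rule bounded_linear_intro)
    show "norm (B x) \<le> norm x * onorm A" for x
      using adjoint_vector_norm_le[OF A eq] by (simp add: mult.commute)
  qed (simp_all add: add scale scaleR_scaleC)
  with scale show ?thesis
    by (simp add: bounded_clinear_def)
qed

text \<open>The set consists of those y at which the adjoint has a value. Along a convergent
  sequence of such y the values are Cauchy by \<open>adjoint_vector_norm_le\<close>, and
  completeness supplies the value at the limit.\<close>

lemma closed_adjoint_domain:
  fixes A :: "'a::complex_hilbert_space \<Rightarrow> 'b::complex_hilbert_space"
  assumes A: "bounded_clinear A"
  shows "closed {y. \<exists>z. \<forall>x. cinner (A x) y = cinner x z}"
  unfolding closed_sequential_limits
proof (intro allI impI, elim conjE)
  fix f y assume f: "\<forall>n. f n \<in> {y. \<exists>z. \<forall>x. cinner (A x) y = cinner x z}"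
    and lim: "f \<longlonglongrightarrow> y"
  then obtain g where g: "\<And>n x. cinner (A x) (f n) = cinner x (g n)"
    by simp metis
  \<comment> \<open>Adding 1 keeps the constant positive even for A = 0, so that division by K is
    legitimate.\<close>
  define K where "K = onorm A + 1"
  have K: "K > 0" "onorm A \<le> K"
    using onorm_pos_le[OF bounded_clinearD(1)[OF A]] by (auto simp: K_def)
  have dist: "dist (g m) (g n) \<le> K * dist (f m) (f n)" for m n
  proof -
    have "norm (g m - g n) \<le> onorm A * norm (f m - f n)"
      by (rule adjoint_vector_norm_le[OF A]) (simp add: cinner_diff_right g)
    also have "\<dots> \<le> K * norm (f m - f n)"
      by (intro mult_right_mono K norm_ge_zero)
    finally show ?thesis
      by (simp add: dist_norm)
  qed
  have "Cauchy g"
  proof (rule metric_CauchyI)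
    fix r :: real assume "r > 0"
    then obtain M where M: "\<And>m n. m \<ge> M \<Longrightarrow> n \<ge> M \<Longrightarrow> dist (f m) (f n) < r / K"
      using metric_CauchyD[OF LIMSEQ_imp_Cauchy[OF lim], of "r / K"] K by auto
    have "dist (g m) (g n) < r" if "m \<ge> M" "n \<ge> M" for m n
    proof -
      have "K * dist (f m) (f n) < r"
        using M[OF that] K by (simp add: field_simps)
      then show ?thesis
        using dist[of m n] by linarith
    qed
    then show "\<exists>M. \<forall>m\<ge>M. \<forall>n\<ge>M. dist (g m) (g n) < r"
      by blast
  qed
  then obtain z where z: "g \<longlonglongrightarrow> z"
    using Cauchy_convergent convergent_def by blast
  have "cinner (A x) y = cinner x z" for x
    using tendsto_cinner_right[OF lim, of "A x"] tendsto_cinner_right[OF z, of x]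
    by (auto simp: g intro: LIMSEQ_unique)
  then show "y \<in> {y. \<exists>z. \<forall>x. cinner (A x) y = cinner x z}"
    by blast
qed

section \<open>Density of the span of a basis, and existence of the adjoint\<close>

lemma orthonormal_basis_induct:
  assumes "orthonormal_basis I e" and "closed {x. P x}" and "complex_vector.subspace {x. P x}"
    and "\<And>i. i \<in> I \<Longrightarrow> P (e i)"
  shows "P x"
proof -
  have "complex_vector.span (e ` I) \<subseteq> {x. P x}"
    using assms by (intro complex_vector.span_minimal) auto
  then have "closure (complex_vector.span (e ` I)) \<subseteq> {x. P x}"
    using assms(2) by (rule closure_minimal)
  then show ?thesis
    using assms(1) by (auto simp: orthonormal_basis_def)
qed

lemma orthonormal_basis_ext:
  fixes A B :: "'a::complex_hilbert_space \<Rightarrow> 'b::complex_hilbert_space"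
  assumes e: "orthonormal_basis I e" and A: "bounded_clinear A" and B: "bounded_clinear B"
    and eq: "\<And>i. i \<in> I \<Longrightarrow> A (e i) = B (e i)"
  shows "A = B"
proof
  fix x
  have cont: "continuous_on UNIV C" if "bounded_clinear C" for C :: "'a \<Rightarrow> 'b"
    using bounded_linear.continuous_on[OF bounded_clinearD(1)[OF that] continuous_on_id] .
  show "A x = B x"
  proof (rule orthonormal_basis_induct[OF e, where P = "\<lambda>x. A x = B x"])
    show "closed {x. A x = B x}"
      by (intro closed_Collect_eq cont A B)
    show "complex_vector.subspace {x. A x = B x}"
      by (rule complex_vector.subspaceI) (simp_all add: bounded_clinearD[OF A] bounded_clinearD[OF B])
  qed (rule eq)
qed

lemma orthonormal_basis_cinner_ext:
  assumes e: "orthonormal_basis I e" and A: "bounded_clinear A"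
    and eq: "\<And>i. i \<in> I \<Longrightarrow> cinner (A (e i)) y = cinner (e i) z"
  shows "cinner (A x) y = cinner x z"
proof (rule orthonormal_basis_induct[OF e, where P = "\<lambda>x. cinner (A x) y = cinner x z"])
  have "isCont A x" for x
    using bounded_linear.isCont[OF bounded_clinearD(1)[OF A] continuous_ident] .
  then have "continuous_on UNIV (\<lambda>x. cinner (A x) y)"
    by (auto simp: continuous_on_def isCont_def intro: tendsto_cinner_left)
  moreover have "continuous_on UNIV (\<lambda>x. cinner x z)"
    by (auto simp: continuous_on_def intro: tendsto_cinner_left)
  ultimately show "closed {x. cinner (A x) y = cinner x z}"
    by (rule closed_Collect_eq)
  show "complex_vector.subspace {x. cinner (A x) y = cinner x z}"
    by (rule complex_vector.subspaceI)
      (simp_all add: bounded_clinearD[OF A] cinner_add_left cinner_scaleC_left)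
qed (rule eq)

text \<open>The vectors at which the adjoint has a value form a closed subspace, so values on the
  basis suffice. This replaces an appeal to Riesz representation, since for a shift these values are
  explicit.\<close>

lemma adjoint_pair_cadjointI:
  assumes e: "orthonormal_basis I e" and A: "bounded_clinear A"
    and adj: "\<And>i. i \<in> I \<Longrightarrow> \<exists>z. \<forall>x. cinner (A x) (e i) = cinner x z"
  shows "adjoint_pair A (cadjoint A)"
proof -
  have "\<exists>z. \<forall>x. cinner (A x) y = cinner x z" for y
  proof (rule orthonormal_basis_induct[OF e, where P = "\<lambda>y. \<exists>z. \<forall>x. cinner (A x) y = cinner x z"])
    show "closed {y. \<exists>z. \<forall>x. cinner (A x) y = cinner x z}"
      by (rule closed_adjoint_domain[OF A])
    show "complex_vector.subspace {y. \<exists>z. \<forall>x. cinner (A x) y = cinner x z}"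
    proof (rule complex_vector.subspaceI)
      show "0 \<in> {y. \<exists>z. \<forall>x. cinner (A x) y = cinner x z}"
        by (auto intro: exI[of _ 0])
    next
      fix y y' assume "y \<in> {y. \<exists>z. \<forall>x. cinner (A x) y = cinner x z}"
        "y' \<in> {y. \<exists>z. \<forall>x. cinner (A x) y = cinner x z}"
      then show "y + y' \<in> {y. \<exists>z. \<forall>x. cinner (A x) y = cinner x z}"
        by (simp add: cinner_add_right) (metis cinner_add_right)
    next
      fix c y assume "y \<in> {y. \<exists>z. \<forall>x. cinner (A x) y = cinner x z}"
      then show "c *\<^sub>C y \<in> {y. \<exists>z. \<forall>x. cinner (A x) y = cinner x z}"
        by (simp add: cinner_scaleC_right) (metis cinner_scaleC_right)
    qed
  qed (rule adj)
  then obtain B where "\<And>x y. cinner (A x) y = cinner x (B y)"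
    by metis
  then have "adjoint_pair A B"
    by (simp add: adjoint_pair_def)
  then show ?thesis
    using cadjoint_eqI by metis
qed

lemma partial_isometryI:
  assumes A: "bounded_clinear A" and AB: "adjoint_pair A B" and ABA: "A \<circ> B \<circ> A = A"
  shows "partial_isometry A"
  unfolding partial_isometry_def
proof (intro conjI allI impI A)
  fix x assume x: "\<forall>y. A y = 0 \<longrightarrow> cinner x y = 0"
  \<comment> \<open>The identity A B A = A puts B A x - x into the kernel, to which x is orthogonal;
    hence B A x and x have the same inner product with x.\<close>
  have "A (B (A x) - x) = 0"
    using fun_cong[OF ABA, of x] linear_diff[OF bounded_linear.linear[OF bounded_clinearD(1)[OF A]]]
    by simp
  then have "cinner x (B (A x) - x) = 0"
    using x by blast
  then have "cinner (A x) (A x) = cinner x x"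
    using AB by (simp add: cinner_diff_right adjoint_pair_def)
  then have "(norm (A x))\<^sup>2 = (norm x)\<^sup>2"
    unfolding cinner_self by (metis of_real_eq_iff)
  then show "norm (A x) = norm x"
    by (simp add: power2_eq_iff_nonneg)
qed

section \<open>The semigroup generated by an operator and its adjoint\<close>

lemma foldr_comp_append:
  "foldr (\<circ>) (us @ vs) id = foldr (\<circ>) us id \<circ> foldr (\<circ>) vs id"
  by (induction us) (simp_all add: comp_assoc)

lemma star_semigroup_comp:
  assumes "A \<in> star_semigroup T" "B \<in> star_semigroup T"
  shows "A \<circ> B \<in> star_semigroup T"
proof -
  obtain us vs where "A = foldr (\<circ>) us id" "us \<noteq> []" "set us \<subseteq> {T, cadjoint T}"
    "B = foldr (\<circ>) vs id" "vs \<noteq> []" "set vs \<subseteq> {T, cadjoint T}"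
    using assms unfolding star_semigroup_def by blast
  then show ?thesis
    unfolding star_semigroup_def
    by (intro CollectI exI[of _ "us @ vs"]) (simp add: foldr_comp_append del: foldr_append)
qed

lemma star_semigroup_generators: "T \<in> star_semigroup T" "cadjoint T \<in> star_semigroup T"
proof -
  show "T \<in> star_semigroup T"
    unfolding star_semigroup_def by (intro CollectI exI[of _ "[T]"]) simp
  show "cadjoint T \<in> star_semigroup T"
    unfolding star_semigroup_def by (intro CollectI exI[of _ "[cadjoint T]"]) simp
qed

text \<open>In the product case both factors are also known to lie in the semigroup, which makes
  their linearity and boundedness available there.\<close>

lemma star_semigroup_induct [consumes 1, case_names gen adj comp]:
  assumes "A \<in> star_semigroup T" and "P T" and "P (cadjoint T)"
    and comp: "\<And>A B. A \<in> star_semigroup T \<Longrightarrow> B \<in> star_semigroup T \<Longrightarrow> P A \<Longrightarrow> P B \<Longrightarrow> P (A \<circ> B)"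
  shows "P A"
proof -
  obtain ws where ws: "A = foldr (\<circ>) ws id" "ws \<noteq> []" "set ws \<subseteq> {T, cadjoint T}"
    using assms(1) unfolding star_semigroup_def by blast
  have "P (foldr (\<circ>) ws id) \<and> foldr (\<circ>) ws id \<in> star_semigroup T"
    using ws(2,3)
  proof (induction ws rule: list_nonempty_induct)
    case (single a)
    then show ?case
      using assms(2,3) star_semigroup_generators by auto
  next
    case (cons a ws)
    have "set ws \<subseteq> {T, cadjoint T}"
      using cons.prems by simp
    then have "P (foldr (\<circ>) ws id) \<and> foldr (\<circ>) ws id \<in> star_semigroup T"
      by (rule cons.IH)
    moreover have "P a \<and> a \<in> star_semigroup T"
      using cons.prems assms(2,3) star_semigroup_generators[of T] by auto
    moreover have "foldr (\<circ>) (a # ws) id = a \<circ> foldr (\<circ>) ws id"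
      by (simp only: foldr.simps o_apply)
    ultimately show ?case
      by (metis comp star_semigroup_comp)
  qed
  then show ?thesis
    using ws(1) by simp
qed

lemma funpow_in_star_semigroup: "k \<ge> 1 \<Longrightarrow> T ^^ k \<in> star_semigroup T"
proof (induction k rule: nat_induct_at_least)
  case base
  then show ?case
    by (simp add: star_semigroup_generators)
next
  case (Suc k)
  then show ?case
    unfolding funpow.simps by (intro star_semigroup_comp star_semigroup_generators)
qed

text \<open>If every element satisfies \<open>A = A A* A\<close>, then \<open>A* = A* A A*\<close> lies in each ideal
  containing \<open>A\<close>.\<close>

lemma SI_semigroupI:
  assumes "\<And>A. A \<in> S \<Longrightarrow> \<exists>B\<in>S. adjoint_pair A B \<and> A \<circ> B \<circ> A = A"
  shows "SI_semigroup S"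
  unfolding SI_semigroup_def
proof (intro allI impI subsetI)
  fix J C assume J: "semigroup_ideal S J" and "C \<in> cadjoint ` J"
  then obtain A where A: "A \<in> J" "C = cadjoint A"
    by blast
  then have "A \<in> S"
    using J by (auto simp: semigroup_ideal_def)
  then obtain B where B: "B \<in> S" "adjoint_pair A B" "A \<circ> B \<circ> A = A"
    using assms by blast
  have "cadjoint (A \<circ> B \<circ> A) = B \<circ> (A \<circ> B)"
    using B(2) by (intro cadjoint_eqI adjoint_pair_compose) (auto dest: adjoint_pair_sym)
  then have "C = B \<circ> (A \<circ> B)"
    using A B by simp
  moreover have "B \<circ> (A \<circ> B) \<in> J"
    using J A(1) B(1) unfolding semigroup_ideal_def by blast
  ultimately show "C \<in> J"
    by simp
qed

text \<open>Multiplying words never removes a letter, so the products with a letter \<open>T\<close>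
  form an ideal, and it contains \<open>T\<close> itself. The result is kept as a list of letters
  because it is later analysed letter by letter.\<close>

lemma SI_semigroup_cadjoint_word:
  assumes "SI_semigroup (star_semigroup T)"
  obtains ws where "set ws \<subseteq> {T, cadjoint T}" "T \<in> set ws" "cadjoint T = foldr (\<circ>) ws id"
proof -
  define J where "J = {foldr (\<circ>) ws id |ws. set ws \<subseteq> {T, cadjoint T} \<and> T \<in> set ws}"
  have "T \<in> J"
    unfolding J_def by (intro CollectI exI[of _ "[T]"]) simp
  have "semigroup_ideal (star_semigroup T) J"
    unfolding semigroup_ideal_def
  proof (intro conjI ballI)
    show "J \<noteq> {}"
      using \<open>T \<in> J\<close> by blast
    show "J \<subseteq> star_semigroup T"
      unfolding J_def star_semigroup_def by fastforce
  next
    fix A X assume "A \<in> J" "X \<in> star_semigroup T"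
    then obtain ws vs where *: "A = foldr (\<circ>) ws id" "set ws \<subseteq> {T, cadjoint T}" "T \<in> set ws"
      "X = foldr (\<circ>) vs id" "set vs \<subseteq> {T, cadjoint T}"
      unfolding J_def star_semigroup_def by blast
    show "X \<circ> A \<in> J"
      unfolding J_def using * by (intro CollectI exI[of _ "vs @ ws"]) (simp add: foldr_comp_append del: foldr_append)
    show "A \<circ> X \<in> J"
      unfolding J_def using * by (intro CollectI exI[of _ "ws @ vs"]) (simp add: foldr_comp_append del: foldr_append)
  qed
  then have "cadjoint T \<in> J"
    using assms \<open>T \<in> J\<close> by (auto simp: SI_semigroup_def)
  then show ?thesis
    using that unfolding J_def by blast
qed

section \<open>Weighted shifts\<close>

locale unilateral_weighted_shift =
  fixes e :: "nat \<Rightarrow> 'a::complex_hilbert_space" and \<alpha> :: "nat \<Rightarrow> complex" and T :: "'a \<Rightarrow> 'a"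
  assumes shift: "weighted_shift e \<alpha> T"
begin

section \<open>Action of the shift and its adjoint on the basis\<close>

lemma basis: "orthonormal_basis {1..} e"
  and bounded_clinear_T: "bounded_clinear T"
  and T_basis: "n \<ge> 1 \<Longrightarrow> T (e n) = \<alpha> n *\<^sub>C e (Suc n)"
  using shift by (auto simp: weighted_shift_def)

lemma cinner_basis: "n \<ge> 1 \<Longrightarrow> m \<ge> 1 \<Longrightarrow> cinner (e n) (e m) = (if n = m then 1 else 0)"
  using basis by (simp add: orthonormal_basis_def)

lemma norm_basis: "n \<ge> 1 \<Longrightarrow> norm (e n) = 1"
  using cinner_self[of "e n"] norm_ge_zero[of "e n"]
  by (simp add: cinner_basis power2_eq_1_iff flip: of_real_power)

lemma basis_nonzero: "n \<ge> 1 \<Longrightarrow> e n \<noteq> 0"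
  using norm_basis by fastforce

text \<open>Together with \<open>cinner_T_basis_1\<close> this exhibits the values of the adjoint on
  the basis before the adjoint is known to exist.\<close>

lemma cinner_T_basis_Suc:
  assumes "n \<ge> 1"
  shows "cinner (T x) (e (Suc n)) = cinner x (cnj (\<alpha> n) *\<^sub>C e n)"
  by (rule orthonormal_basis_cinner_ext[OF basis bounded_clinear_T])
    (use assms in \<open>simp add: T_basis cinner_scaleC_left cinner_scaleC_right cinner_basis\<close>)

lemma cinner_T_basis_1: "cinner (T x) (e 1) = cinner x 0"
  by (rule orthonormal_basis_cinner_ext[OF basis bounded_clinear_T])
    (simp add: T_basis cinner_scaleC_left cinner_basis)

lemma adjoint_pair_T: "adjoint_pair T (cadjoint T)"
proof (rule adjoint_pair_cadjointI[OF basis bounded_clinear_T])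
  fix i :: nat assume i: "i \<in> {1..}"
  show "\<exists>z. \<forall>x. cinner (T x) (e i) = cinner x z"
  proof (cases "i = 1")
    case True
    then show ?thesis
      using cinner_T_basis_1 by blast
  next
    case False
    then obtain n where "i = Suc n" "n \<ge> 1"
      using i by (cases i) auto
    then show ?thesis
      using cinner_T_basis_Suc by blast
  qed
qed

lemma bounded_clinear_cadjoint: "bounded_clinear (cadjoint T)"
  by (rule bounded_clinear_adjoint_pair[OF bounded_clinear_T adjoint_pair_T])

lemma cadjoint_basis_Suc: "n \<ge> 1 \<Longrightarrow> cadjoint T (e (Suc n)) = cnj (\<alpha> n) *\<^sub>C e n"
  using adjoint_pair_T cinner_T_basis_Suc
  by (intro cinner_right_cancel) (metis adjoint_pair_def)

lemma cadjoint_basis_1: "cadjoint T (e 1) = 0"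
  using adjoint_pair_T cinner_T_basis_1
  by (intro cinner_right_cancel) (metis adjoint_pair_def)

lemma star_semigroup_bounded_clinear: "A \<in> star_semigroup T \<Longrightarrow> bounded_clinear A"
  by (induction rule: star_semigroup_induct)
    (blast intro: bounded_clinear_T bounded_clinear_cadjoint bounded_clinear_compose)+

text \<open>Unlike the identity \<open>A B A = A\<close>, which it implies, this property is inherited by products.\<close>

definition monomial_pair :: "('a \<Rightarrow> 'a) \<Rightarrow> ('a \<Rightarrow> 'a) \<Rightarrow> bool" where
  "monomial_pair A B \<longleftrightarrow> (\<forall>n\<ge>1. A (e n) = 0 \<or>
     (\<exists>m\<ge>1. \<exists>c. cmod c = 1 \<and> A (e n) = c *\<^sub>C e m \<and> B (e m) = cnj c *\<^sub>C e n))"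

text \<open>If the product does not kill e n, both factors move basis vectors, n to m to k, with
  unimodular coefficients; the partners retrace this path and the coefficients multiply.\<close>

lemma monomial_pair_compose:
  assumes lin: "bounded_clinear A" "bounded_clinear B'"
    and AB: "monomial_pair A B" and AB': "monomial_pair A' B'"
  shows "monomial_pair (A \<circ> A') (B' \<circ> B)"
  unfolding monomial_pair_def
proof (intro allI impI)
  fix n :: nat assume n: "n \<ge> 1"
  show "(A \<circ> A') (e n) = 0 \<or>
    (\<exists>m\<ge>1. \<exists>c. cmod c = 1 \<and> (A \<circ> A') (e n) = c *\<^sub>C e m \<and> (B' \<circ> B) (e m) = cnj c *\<^sub>C e n)"
  proof (cases "(A \<circ> A') (e n) = 0")
    case False
    then have "A' (e n) \<noteq> 0"
      using bounded_clinearD(4)[OF lin(1)] by auto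
    then obtain m c where m: "m \<ge> 1" "cmod c = 1" "A' (e n) = c *\<^sub>C e m" "B' (e m) = cnj c *\<^sub>C e n"
      using AB' n by (auto simp: monomial_pair_def)
    then have "A (e m) \<noteq> 0"
      using False bounded_clinearD(3)[OF lin(1)] by auto
    then obtain k d where k: "k \<ge> 1" "cmod d = 1" "A (e m) = d *\<^sub>C e k" "B (e k) = cnj d *\<^sub>C e m"
      using AB m by (auto simp: monomial_pair_def)
    have "cmod (c * d) = 1" "(A \<circ> A') (e n) = (c * d) *\<^sub>C e k"
      "(B' \<circ> B) (e k) = cnj (c * d) *\<^sub>C e n"
      using m k
      by (simp_all add: norm_mult bounded_clinearD(3)[OF lin(1)] bounded_clinearD(3)[OF lin(2)]
          scaleC_scaleC mult.commute)
    then show ?thesis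
      using k(1) by blast
  qed simp
qed

lemma monomial_pair_triple:
  assumes A: "bounded_clinear A" and B: "bounded_clinear B" and AB: "monomial_pair A B"
  shows "A \<circ> B \<circ> A = A"
proof (rule orthonormal_basis_ext[OF basis])
  show "bounded_clinear (A \<circ> B \<circ> A)"
    by (intro bounded_clinear_compose A B)
  fix n :: nat assume "n \<in> {1..}"
  then consider "A (e n) = 0"
    | m c where "m \<ge> 1" "cmod c = 1" "A (e n) = c *\<^sub>C e m" "B (e m) = cnj c *\<^sub>C e n"
    using AB by (auto simp: monomial_pair_def)
  then show "(A \<circ> B \<circ> A) (e n) = A (e n)"
  proof cases
    case 1
    then show ?thesis
      using bounded_clinearD(4)[OF A] bounded_clinearD(4)[OF B] by simp
  next
    case 2
    have "c * cnj c = 1"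
      using 2(2) complex_norm_square[of c] by simp
    then show ?thesis
      using 2 by (simp add: bounded_clinearD(3)[OF A] bounded_clinearD(3)[OF B] scaleC_scaleC mult.assoc)
  qed
qed (rule A)

lemma monomial_pair_T:
  assumes "\<And>n. n \<ge> 1 \<Longrightarrow> cmod (\<alpha> n) \<in> {0, 1}"
  shows "monomial_pair T (cadjoint T)" and "monomial_pair (cadjoint T) T"
proof -
  show "monomial_pair T (cadjoint T)"
    unfolding monomial_pair_def
  proof (intro allI impI)
    fix n :: nat assume n: "n \<ge> 1"
    show "T (e n) = 0 \<or>
      (\<exists>m\<ge>1. \<exists>c. cmod c = 1 \<and> T (e n) = c *\<^sub>C e m \<and> cadjoint T (e m) = cnj c *\<^sub>C e n)"
    proof (cases "\<alpha> n = 0")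
      case True
      then show ?thesis
        using T_basis[OF n] by simp
    next
      case False
      then show ?thesis
        using assms[OF n] n T_basis[OF n] cadjoint_basis_Suc[OF n]
        by (intro disjI2 exI[of _ "Suc n"] exI[of _ "\<alpha> n"] conjI) auto
    qed
  qed
  show "monomial_pair (cadjoint T) T"
    unfolding monomial_pair_def
  proof (intro allI impI)
    fix n :: nat assume n: "n \<ge> 1"
    show "cadjoint T (e n) = 0 \<or>
      (\<exists>m\<ge>1. \<exists>c. cmod c = 1 \<and> cadjoint T (e n) = c *\<^sub>C e m \<and> T (e m) = cnj c *\<^sub>C e n)"
    \<comment> \<open>The adjoint lowers the index, so e 1 has no image to move to and is
      annihilated.\<close>
    proof (cases "n = 1")
      case True
      then show ?thesis
        using cadjoint_basis_1 by simp
    next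
      case False
      then obtain m where m: "n = Suc m" "m \<ge> 1"
        using n by (cases n) auto
      show ?thesis
      proof (cases "\<alpha> m = 0")
        case True
        then show ?thesis
          using cadjoint_basis_Suc[OF m(2)] m by simp
      next
        case False
        then show ?thesis
          using assms[OF m(2)] m T_basis[OF m(2)] cadjoint_basis_Suc[OF m(2)]
          by (intro disjI2 exI[of _ m] exI[of _ "cnj (\<alpha> m)"] conjI) auto
      qed
    qed
  qed
qed

text \<open>The partner of a word is the reversed word with \<open>T\<close> and its adjoint
  exchanged, so it stays in the semigroup.\<close>

lemma star_semigroup_triple:
  assumes \<alpha>: "\<And>n. n \<ge> 1 \<Longrightarrow> cmod (\<alpha> n) \<in> {0, 1}" and A: "A \<in> star_semigroup T"
  shows "\<exists>B\<in>star_semigroup T. adjoint_pair A B \<and> A \<circ> B \<circ> A = A"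
proof -
  have "\<exists>B\<in>star_semigroup T. adjoint_pair A B \<and> monomial_pair A B"
    using A
  proof (induction rule: star_semigroup_induct)
    case gen
    then show ?case
      using star_semigroup_generators adjoint_pair_T monomial_pair_T[OF \<alpha>] by blast
  next
    case adj
    then show ?case
      using star_semigroup_generators adjoint_pair_sym[OF adjoint_pair_T] monomial_pair_T[OF \<alpha>]
      by blast
  next
    case (comp A A')
    then obtain B B' where "B \<in> star_semigroup T" "adjoint_pair A B" "monomial_pair A B"
      "B' \<in> star_semigroup T" "adjoint_pair A' B'" "monomial_pair A' B'"
      by blast
    then show ?case
      using comp(1,2)
      by (intro bexI[of _ "B' \<circ> B"] conjI adjoint_pair_compose monomial_pair_compose
          star_semigroup_comp star_semigroup_bounded_clinear)
  qed
  then show ?thesis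
    using A monomial_pair_triple star_semigroup_bounded_clinear by metis
qed

lemma power_partial_isometry_if_weights:
  assumes "\<And>n. n \<ge> 1 \<Longrightarrow> cmod (\<alpha> n) \<in> {0, 1}"
  shows "power_partial_isometry T"
  unfolding power_partial_isometry_def
proof (intro allI impI)
  fix k :: nat assume "k \<ge> 1"
  then have k: "T ^^ k \<in> star_semigroup T"
    by (rule funpow_in_star_semigroup)
  then show "partial_isometry (T ^^ k)"
    using star_semigroup_triple[OF assms k] star_semigroup_bounded_clinear partial_isometryI by blast
qed

text \<open>The first power already decides: if \<alpha> n is nonzero, then e n is orthogonal to the
  kernel, so \<bar>\<alpha> n\<bar> = norm (T (e n)) = 1.\<close>

lemma weights_if_partial_isometry:
  assumes "partial_isometry T" "n \<ge> 1"
  shows "cmod (\<alpha> n) \<in> {0, 1}"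
proof (cases "\<alpha> n = 0")
  case False
  have "cinner (e n) y = 0" if "T y = 0" for y
  proof -
    have "\<alpha> n * cinner y (e n) = 0"
      using cinner_T_basis_Suc[OF assms(2), of y] unfolding that cinner_scaleC_right by simp
    then have "cinner y (e n) = 0"
      using False by simp
    then show ?thesis
      using cinner_commute[of "e n" y] by simp
  qed
  then have "norm (T (e n)) = norm (e n)"
    using assms(1) by (simp add: partial_isometry_def)
  then show ?thesis
    using assms(2) by (simp add: T_basis norm_scaleC norm_basis)
qed simp

section \<open>Alternating words and what SI forces on the weights\<close>

lemma T_cadjoint_power_basis:
  assumes "n \<ge> 1"
  shows "((T \<circ> cadjoint T) ^^ k) (e (Suc n)) = complex_of_real (cmod (\<alpha> n) ^ (2 * k)) *\<^sub>C e (Suc n)"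
proof (induction k)
  case (Suc k)
  note lin = bounded_clinearD(3)[OF bounded_clinear_T] bounded_clinearD(3)[OF bounded_clinear_cadjoint]
  have "T (cadjoint T (e (Suc n))) = (cnj (\<alpha> n) * \<alpha> n) *\<^sub>C e (Suc n)"
    using assms by (simp only: cadjoint_basis_Suc T_basis lin scaleC_scaleC)
  also have "cnj (\<alpha> n) * \<alpha> n = complex_of_real (cmod (\<alpha> n) ^ 2)"
    by (simp only: complex_norm_square mult.commute)
  finally have "T (cadjoint T (complex_of_real (cmod (\<alpha> n) ^ (2 * k)) *\<^sub>C e (Suc n))) =
      complex_of_real (cmod (\<alpha> n) ^ (2 * k) * cmod (\<alpha> n) ^ 2) *\<^sub>C e (Suc n)"
    by (simp only: lin scaleC_scaleC of_real_mult)
  moreover have "cmod (\<alpha> n) ^ (2 * k) * cmod (\<alpha> n) ^ 2 = cmod (\<alpha> n) ^ (2 * Suc k)"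
    by (simp flip: power_add)
  moreover have "((T \<circ> cadjoint T) ^^ Suc k) x = T (cadjoint T (((T \<circ> cadjoint T) ^^ k) x))" for x
    by simp
  ultimately show ?case
    by (simp only: Suc.IH)
qed simp

lemma cadjoint_T_cadjoint_power_basis:
  assumes "n \<ge> 1"
  shows "(cadjoint T \<circ> (T \<circ> cadjoint T) ^^ k) (e (Suc n)) =
    (complex_of_real (cmod (\<alpha> n) ^ (2 * k)) * cnj (\<alpha> n)) *\<^sub>C e n"
  using assms
  by (subst o_apply)
    (simp only: T_cadjoint_power_basis bounded_clinearD(3)[OF bounded_clinear_cadjoint]
      cadjoint_basis_Suc scaleC_scaleC)

text \<open>One operator kills e (i + 1), the other does not. Words are lists of operators, so this
  is what lets the two letters be told apart in \<open>alternating_word\<close>.\<close>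

lemma T_neq_cadjoint:
  assumes "i \<ge> 1" "\<alpha> i \<noteq> 0" "\<alpha> (Suc i) = 0"
  shows "T \<noteq> cadjoint T"
proof
  assume "T = cadjoint T"
  then have "T (e (Suc i)) = cadjoint T (e (Suc i))"
    by simp
  then show False
    using assms basis_nonzero[of i] by (simp add: T_basis cadjoint_basis_Suc)
qed

text \<open>Let \<open>e j, \<dots>, e (i + 1)\<close> be a maximal block linked by nonzero weights. A word that annihilates
  neither \<open>e (i + 1)\<close> nor \<open>e (j + 1)\<close> can only alternate between the two levels: raising above the
  start annihilates the former, lowering twice annihilates the latter.\<close>

lemma alternating_word:
  assumes i: "i \<ge> 1" "\<alpha> i \<noteq> 0" "\<alpha> (Suc i) = 0"
    and j: "j \<ge> 1" "cadjoint T (e j) = 0"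
    and ws: "set ws \<subseteq> {T, cadjoint T}"
      "foldr (\<circ>) ws id (e (Suc i)) \<noteq> 0" "foldr (\<circ>) ws id (e (Suc j)) \<noteq> 0"
  shows "\<exists>k. (T \<in> set ws \<longrightarrow> k \<ge> 1) \<and>
    (foldr (\<circ>) ws id = (T \<circ> cadjoint T) ^^ k \<or>
     foldr (\<circ>) ws id = cadjoint T \<circ> (T \<circ> cadjoint T) ^^ k)"
  using ws
proof (induction ws)
  case Nil
  then show ?case
    by (intro exI[of _ 0]) auto
next
  case (Cons a ws)
  have a: "a = T \<or> a = cadjoint T"
    using Cons.prems(1) by auto
  have word: "foldr (\<circ>) (a # ws) id = a \<circ> foldr (\<circ>) ws id"
    by (simp only: foldr.simps o_apply)
  then have step: "foldr (\<circ>) (a # ws) id x = a (foldr (\<circ>) ws id x)" for x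
    by simp
  have "a 0 = 0"
    using a bounded_clinearD(4) bounded_clinear_T bounded_clinear_cadjoint by metis
  then have "foldr (\<circ>) ws id (e (Suc i)) \<noteq> 0" "foldr (\<circ>) ws id (e (Suc j)) \<noteq> 0"
    using Cons.prems(2,3) unfolding step by metis+
  then obtain k where k: "T \<in> set ws \<longrightarrow> k \<ge> 1" and
    "foldr (\<circ>) ws id = (T \<circ> cadjoint T) ^^ k \<or>
     foldr (\<circ>) ws id = cadjoint T \<circ> (T \<circ> cadjoint T) ^^ k"
    using Cons.IH Cons.prems(1) by (metis insert_subset list.simps(15))
  from this(2) show ?case
  proof
    assume w: "foldr (\<circ>) ws id = (T \<circ> cadjoint T) ^^ k"
    \<comment> \<open>The word so far maps e (i + 1) to a multiple of itself, and the zero weight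
      \<alpha> (i + 1) prevents raising it.\<close>
    have "T (foldr (\<circ>) ws id (e (Suc i))) = 0"
      unfolding w T_cadjoint_power_basis[OF i(1)] using i
      by (simp add: T_basis bounded_clinearD(3)[OF bounded_clinear_T])
    then have "a = cadjoint T"
      using a Cons.prems(2) unfolding step by metis
    \<comment> \<open>The new letter differs from \<open>T\<close>, so any \<open>T\<close> already
      occurs in \<open>ws\<close> and the bound on k carries over.\<close>
    then have "T \<in> set (a # ws) \<longrightarrow> k \<ge> 1"
      using k T_neq_cadjoint[OF i] by simp
    then show ?thesis
      unfolding word w using \<open>a = cadjoint T\<close> by blast
  next
    assume w: "foldr (\<circ>) ws id = cadjoint T \<circ> (T \<circ> cadjoint T) ^^ k"
    \<comment> \<open>The word so far lowers e (j + 1) to a multiple of e j, the bottom of the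
      block, which the adjoint kills.\<close>
    have "cadjoint T (foldr (\<circ>) ws id (e (Suc j))) = 0"
      unfolding w cadjoint_T_cadjoint_power_basis[OF j(1)]
      by (simp add: j bounded_clinearD(3)[OF bounded_clinear_cadjoint])
    then have "a = T"
      using a Cons.prems(3) unfolding step by metis
    then have "a \<circ> (cadjoint T \<circ> (T \<circ> cadjoint T) ^^ k) = (T \<circ> cadjoint T) ^^ Suc k"
      by (simp only: funpow.simps(2) comp_assoc)
    then show ?thesis
      unfolding word w by (intro exI[of _ "Suc k"] conjI impI disjI1) simp
  qed
qed

text \<open>A block begins either at index 1 or just after a zero weight; in both cases the adjoint
  kills its first vector.\<close>

lemma block_start:
  assumes "i \<ge> 1" "\<alpha> i \<noteq> 0"
  shows "\<exists>j\<ge>1. \<alpha> j \<noteq> 0 \<and> cadjoint T (e j) = 0"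
  using assms
proof (induction i rule: nat_induct_at_least)
  case base
  then show ?case
    using cadjoint_basis_1 by auto
next
  case (Suc i)
  show ?case
  proof (cases "\<alpha> i = 0")
    case True
    then show ?thesis
      using Suc cadjoint_basis_Suc[of i] by (intro exI[of _ "Suc i"]) simp
  next
    case False
    then show ?thesis
      using Suc by blast
  qed
qed

lemma weights_if_SI:
  assumes i: "i \<ge> 1" "\<alpha> i \<noteq> 0" "\<alpha> (Suc i) = 0"
    and SI: "SI_semigroup (star_semigroup T)" and n: "n \<ge> 1"
  shows "cmod (\<alpha> n) \<in> {0, 1}"
proof -
  obtain j where j: "j \<ge> 1" "\<alpha> j \<noteq> 0" "cadjoint T (e j) = 0"
    using block_start[OF i(1,2)] by blast
  obtain ws where ws: "set ws \<subseteq> {T, cadjoint T}" "T \<in> set ws" "cadjoint T = foldr (\<circ>) ws id"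
    using SI_semigroup_cadjoint_word[OF SI] .
  \<comment> \<open>The word equals the adjoint, which kills neither vector because \<alpha> i and
    \<alpha> j are nonzero.\<close>
  have "foldr (\<circ>) ws id (e (Suc i)) \<noteq> 0" "foldr (\<circ>) ws id (e (Suc j)) \<noteq> 0"
    unfolding ws(3)[symmetric] using i j basis_nonzero by (simp_all add: cadjoint_basis_Suc)
  then obtain k where k: "k \<ge> 1" and
    alt: "cadjoint T = (T \<circ> cadjoint T) ^^ k \<or> cadjoint T = cadjoint T \<circ> (T \<circ> cadjoint T) ^^ k"
    using alternating_word[OF i j(1,3) ws(1)] ws(2,3) by auto
  \<comment> \<open>The power of T T* keeps e (i + 1) on its own line, while the adjoint sends it to
    a nonzero multiple of e i.\<close>
  have "cadjoint T \<noteq> (T \<circ> cadjoint T) ^^ k"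
  proof
    assume "cadjoint T = (T \<circ> cadjoint T) ^^ k"
    then have "cnj (\<alpha> i) *\<^sub>C e i = complex_of_real (cmod (\<alpha> i) ^ (2 * k)) *\<^sub>C e (Suc i)"
      using T_cadjoint_power_basis[OF i(1), of k] cadjoint_basis_Suc[OF i(1)] by metis
    then have "cinner (cnj (\<alpha> i) *\<^sub>C e i) (e i) =
        cinner (complex_of_real (cmod (\<alpha> i) ^ (2 * k)) *\<^sub>C e (Suc i)) (e i)"
      by simp
    then show False
      using i by (simp add: cinner_scaleC_left cinner_basis)
  qed
  then have "cadjoint T = cadjoint T \<circ> (T \<circ> cadjoint T) ^^ k"
    using alt by blast
  \<comment> \<open>The block has served only to find the operator identity; evaluating it at e (n +
    1) reaches every weight, inside the block or not.\<close>
  then have "cnj (\<alpha> n) *\<^sub>C e n = (complex_of_real (cmod (\<alpha> n) ^ (2 * k)) * cnj (\<alpha> n)) *\<^sub>C e n"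
    using cadjoint_T_cadjoint_power_basis[OF n, of k] cadjoint_basis_Suc[OF n] by metis
  then have "cnj (\<alpha> n) = complex_of_real (cmod (\<alpha> n) ^ (2 * k)) * cnj (\<alpha> n)"
    using basis_nonzero[OF n] by (simp add: complex_vector.scale_right_imp_eq)
  then have "\<alpha> n = 0 \<or> complex_of_real (cmod (\<alpha> n) ^ (2 * k)) = 1"
    by simp
  then have "\<alpha> n = 0 \<or> cmod (\<alpha> n) ^ (2 * k) = 1"
    by (metis of_real_eq_1_iff)
  then show ?thesis
    using k power_eq_imp_eq_base[of "cmod (\<alpha> n)" "2 * k" 1] by auto
qed

text \<open>A zero weight makes the span of \<open>e 1, \<dots>, e i\<close> reducing, and \<open>T\<close> is nilpotent on it.\<close>

lemma star_semigroup_block_invariant: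
  assumes A: "A \<in> star_semigroup T" and i: "\<alpha> i = 0" and n: "n \<in> {1..i}"
  shows "\<exists>m\<in>{1..i}. \<exists>c. A (e n) = c *\<^sub>C e m"
  using A n
proof (induction arbitrary: n rule: star_semigroup_induct)
  case gen
  show ?case
  proof (cases "n = i")
    case True
    then show ?thesis
      using gen i T_basis[of n] by (intro bexI[of _ n] exI[of _ 0]) auto
  next
    case False
    then show ?thesis
      using gen T_basis[of n] by (intro bexI[of _ "Suc n"] exI[of _ "\<alpha> n"]) auto
  qed
next
  case adj
  show ?case
  proof (cases "n = 1")
    case True
    then show ?thesis
      using adj cadjoint_basis_1 by (intro bexI[of _ n] exI[of _ 0]) auto
  next
    case False
    then obtain m where "n = Suc m" "m \<ge> 1"
      using adj by (cases n) auto
    then show ?thesis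
      using adj cadjoint_basis_Suc[of m] by (intro bexI[of _ m] exI[of _ "cnj (\<alpha> m)"]) auto
  qed
next
  case (comp A B)
  obtain m c where m: "m \<in> {1..i}" "B (e n) = c *\<^sub>C e m"
    using comp.IH(2)[OF comp.prems] by blast
  obtain k d where "k \<in> {1..i}" "A (e m) = d *\<^sub>C e k"
    using comp.IH(1)[OF m(1)] by blast
  then show ?case
    using m(2) bounded_clinearD(3)[OF star_semigroup_bounded_clinear[OF comp.hyps(1)]]
    by (intro bexI[of _ k] exI[of _ "c * d"]) (simp_all add: scaleC_scaleC)
qed

text \<open>Each application raises the index by one, so a path of k steps from e n with k + n > i
  has to cross the zero weight at i.\<close>

lemma funpow_T_block:
  assumes i: "\<alpha> i = 0" and n: "n \<in> {1..i}" and k: "k + n > i"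
  shows "(T ^^ k) (e n) = 0"
  using n k
proof (induction k arbitrary: n)
  case (Suc k)
  \<comment> \<open>The zeroth power is the identity, which need not be a word, so that case is
    treated directly.\<close>
  have lin: "bounded_clinear (T ^^ k)"
    using star_semigroup_bounded_clinear funpow_in_star_semigroup[of k T]
    by (cases "k = 0") (auto simp: bounded_clinear_def id_def intro: bounded_linear_ident)
  have eq: "(T ^^ Suc k) (e n) = \<alpha> n *\<^sub>C (T ^^ k) (e (Suc n))"
    using Suc.prems by (simp add: funpow_swap1 T_basis bounded_clinearD(3)[OF lin])
  show ?case
  proof (cases "n = i")
    case True
    then show ?thesis
      using eq i by simp
  next
    case False
    then show ?thesis
      using eq Suc by simp
  qed
qed simp

text \<open>Nilpotence of \<open>T\<close> on the block puts T^(i + 1) into the ideal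
  \<open>J\<close>, while \<alpha> i \<noteq> 0 keeps \<open>T\<close> itself out of it.\<close>

lemma not_simple:
  assumes i: "i \<ge> 1" "\<alpha> i \<noteq> 0" "\<alpha> (Suc i) = 0"
  shows "\<not> simple_semigroup (star_semigroup T)"
proof
  define J where "J = {A \<in> star_semigroup T. \<forall>n\<in>{1..Suc i}. A (e n) = 0}"
  assume "simple_semigroup (star_semigroup T)"
  moreover have "semigroup_ideal (star_semigroup T) J"
    unfolding semigroup_ideal_def
  proof (intro conjI ballI)
    have "T ^^ Suc i \<in> J"
      unfolding J_def
      by (intro CollectI conjI ballI funpow_in_star_semigroup funpow_T_block[where i = "Suc i"])
        (use i(3) in auto)
    then show "J \<noteq> {}"
      by blast
    show "J \<subseteq> star_semigroup T"
      by (auto simp: J_def)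
  next
    fix A X assume AX: "A \<in> J" "X \<in> star_semigroup T"
    then have A: "A \<in> star_semigroup T"
      by (simp add: J_def)
    show "X \<circ> A \<in> J"
      using AX star_semigroup_comp[OF AX(2) A]
        bounded_clinearD(4)[OF star_semigroup_bounded_clinear[OF AX(2)]]
      by (simp add: J_def)
    \<comment> \<open>Right multiplication is the side that uses invariance: X sends a block vector
      to a multiple of a block vector, which A kills.\<close>
    have "A (X (e n)) = 0" if n: "n \<in> {1..Suc i}" for n
    proof -
      obtain m c where "m \<in> {1..Suc i}" "X (e n) = c *\<^sub>C e m"
        using star_semigroup_block_invariant[OF AX(2) i(3) n] by blast
      then show ?thesis
        using AX(1) bounded_clinearD(3)[OF star_semigroup_bounded_clinear[OF A]]
        by (simp add: J_def)
    qed
    then show "A \<circ> X \<in> J"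
      using star_semigroup_comp[OF A AX(2)] by (simp add: J_def)
  qed
  ultimately have "T \<in> J"
    using star_semigroup_generators by (auto simp: simple_semigroup_def)
  then have "T (e i) = 0"
    using i(1) by (simp add: J_def)
  then show False
    using i basis_nonzero[of "Suc i"] by (simp add: T_basis)
qed

end

theorem theorem3p2:
  fixes e :: "nat \<Rightarrow> 'a::complex_hilbert_space"
    and \<alpha> :: "nat \<Rightarrow> complex"
    and T :: "'a \<Rightarrow> 'a"
  assumes "weighted_shift e \<alpha> T"
    and "bounded (\<alpha> ` {1..})"
    and "\<exists>i\<ge>1. \<alpha> i \<noteq> 0 \<and> \<alpha> (i + 1) = 0"
  shows "(SI_semigroup (star_semigroup T) \<longleftrightarrow> (\<forall>n\<ge>1. cmod (\<alpha> n) \<in> {0, 1})) \<and>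
         ((\<forall>n\<ge>1. cmod (\<alpha> n) \<in> {0, 1}) \<longleftrightarrow> power_partial_isometry T) \<and>
         (SI_semigroup (star_semigroup T) \<longrightarrow> \<not> simple_semigroup (star_semigroup T))"
proof -
  interpret unilateral_weighted_shift e \<alpha> T
    by unfold_locales (rule assms(1))
  obtain i where i: "i \<ge> 1" "\<alpha> i \<noteq> 0" "\<alpha> (Suc i) = 0"
    using assms(3) by auto
  have "SI_semigroup (star_semigroup T) \<longleftrightarrow> (\<forall>n\<ge>1. cmod (\<alpha> n) \<in> {0, 1})"
    using weights_if_SI[OF i] star_semigroup_triple SI_semigroupI by blast
  moreover have "partial_isometry T" if "power_partial_isometry T"
    using that[unfolded power_partial_isometry_def, rule_format, of 1] by simp
  then have "(\<forall>n\<ge>1. cmod (\<alpha> n) \<in> {0, 1}) \<longleftrightarrow> power_partial_isometry T"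
    using power_partial_isometry_if_weights weights_if_partial_isometry by blast
  ultimately show ?thesis
    using not_simple[OF i] by blast
qed

end
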